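(* Let $g\geq 2$ be an integer and let $a\in\mathbb{N}$ satisfy $\gcd(g,a)=1$. Let $\mathcal{D}=\{d_1,\dots,d_t\}\subseteq\{0,\dots,g-1\}$ with $d_1<\dots<d_t$ and $t\geq 2$. Then $\mathcal{C}_{g,\mathcal{D}}$ is uniformly distributed mod $a$ if and only if $\gcd(a,d_2-d_1,\dots,d_t-d_1)=1$.
   Context: $\mathbb{N}=\{1,2,\dots\}$ and $\mathbb{N}_0=\mathbb{N}\cup\{0\}$. The missing digits set is $\mathcal{C}_{g,\mathcal{D}}=\{\sum_{i=0}^m w_ig^i:\ m\in\mathbb{N}_0,\ w_i\in\mathcal{D}\}$. A set $A\subseteq\mathbb{N}_0$ is uniformly distributed mod $a$ if $\lim_{N\to\infty}\frac{|\{n\in A:\ n\equiv b \pmod a\}\cap[0,N)|}{|A\cap[0,N)|}=\frac1a$ for every $b\in\mathbb{Z}/a\mathbb{Z}$. *)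

theory Defs
  imports Complex_Main "HOL-Number_Theory.Cong"
begin

definition missing_digits_set :: "nat \<Rightarrow> nat set \<Rightarrow> nat set" where
  "missing_digits_set g D =
     {(\<Sum>i\<le>m. w i * g ^ i) | (m :: nat) (w :: nat \<Rightarrow> nat). \<forall>i\<le>m. w i \<in> D}"

(* The residue classes mod a are represented by b = 0, ..., a - 1. *)
definition uniformly_distributed_mod :: "nat set \<Rightarrow> nat \<Rightarrow> bool" where
  "uniformly_distributed_mod A a \<longleftrightarrow>
     (\<forall>b<a. (\<lambda>N. real (card ({n \<in> A. [n = b] (mod a)} \<inter> {0..<N})) / real (card (A \<inter> {0..<N})))
              \<longlonglongrightarrow> 1 / real a)"

end

theory Submission
  imports Defs "HOL-Number_Theory.Residues"
begin

text \<open>If the digit differences and \<open>a\<close> have gcd 1, there is a length \<open>L\<close> with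
  \<open>g^L = 1\<close> modulo \<open>a\<close> such that the sums of \<open>L\<close> digits hit every residue class. Up to an
  error bounded in terms of \<open>L\<close>, the elements of the set below \<open>N\<close> are the numbers
  \<open>r + g^L q\<close> with \<open>r\<close> a sum of \<open>L\<close> digits and \<open>q < N div g^L\<close> in the set. This writes
  the deviations from equidistribution at \<open>N\<close> as sums of deviations at \<open>N div g^L\<close>, in which the
  terms of a complete residue system cancel; so the relative deviation contracts to 0.

  Conversely, if the gcd is \<open>h > 1\<close>, all elements with the same number of digits agree
  modulo \<open>h\<close>, and each such block makes up at least half of the elements up to its end.\<close>

section \<open>Digit strings of fixed length: concatenation and splitting\<close>

text \<open>Fixing the length makes concatenation exact: leading zeros count as digits when 0 is in
  \<open>D\<close>, and the empty string, of value 0, is neutral. The recursion adds the most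
  significant digit.\<close>

primrec digit_sums :: "nat \<Rightarrow> nat set \<Rightarrow> nat \<Rightarrow> nat set" where
  "digit_sums g D 0 = {0}"
| "digit_sums g D (Suc L) = (\<lambda>(r, x). r + x * g ^ L) ` (digit_sums g D L \<times> D)"

lemma digit_sums_eq:
  "digit_sums g D L = {(\<Sum>i<L. w i * g ^ i) | w. \<forall>i<L. w i \<in> D}"
proof (induction L)
  case 0
  show ?case by auto
next
  case (Suc L)
  show ?case
  proof (intro equalityI subsetI)
    fix n assume "n \<in> digit_sums g D (Suc L)"
    then obtain w x where w: "\<forall>i<L. w i \<in> D" and x: "x \<in> D"
      and n: "n = (\<Sum>i<L. w i * g ^ i) + x * g ^ L"
      using Suc by auto
    have "(\<Sum>i<L. (w(L := x)) i * g ^ i) = (\<Sum>i<L. w i * g ^ i)"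
      by (rule sum.cong) auto
    then have "n = (\<Sum>i<Suc L. (w(L := x)) i * g ^ i)"
      using n by simp
    moreover have "\<forall>i<Suc L. (w(L := x)) i \<in> D"
      using w x by (auto simp: less_Suc_eq)
    ultimately show "n \<in> {(\<Sum>i<Suc L. w i * g ^ i) | w. \<forall>i<Suc L. w i \<in> D}"
      by blast
  next
    fix n assume "n \<in> {(\<Sum>i<Suc L. w i * g ^ i) | w. \<forall>i<Suc L. w i \<in> D}"
    then obtain w where w: "\<forall>i<Suc L. w i \<in> D" and n: "n = (\<Sum>i<Suc L. w i * g ^ i)"
      by blast
    have "(\<Sum>i<L. w i * g ^ i) \<in> digit_sums g D L"
      using Suc w by auto
    moreover have "n = (\<Sum>i<L. w i * g ^ i) + w L * g ^ L" using n by simp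
    ultimately show "n \<in> digit_sums g D (Suc L)" using w by force
  qed
qed

text \<open>Lengths start at 1: the empty string must not contribute its value 0, which belongs to
  the set only if 0 is a digit.\<close>

lemma missing_digits_set_eq: "missing_digits_set g D = (\<Union>m. digit_sums g D (Suc m))"
  unfolding missing_digits_set_def digit_sums_eq lessThan_Suc_atMost less_Suc_eq_le by blast

lemma digit_sums_1 [simp]: "digit_sums g D (Suc 0) = D"
  by (auto simp: image_iff)

lemma digit_sums_append:
  assumes "r \<in> digit_sums g D L" "q \<in> digit_sums g D K"
  shows "r + g ^ L * q \<in> digit_sums g D (L + K)"
  using assms(2)
proof (induction K arbitrary: q)
  case 0
  then show ?case using assms(1) by simp
next
  case (Suc K)
  then obtain q' x where "q' \<in> digit_sums g D K" "x \<in> D" "q = q' + x * g ^ K" by auto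
  with Suc.IH[of q'] show ?case
    by (auto intro!: image_eqI[where x = "(r + g ^ L * q', x)"] simp: algebra_simps power_add)
qed

lemma digit_sums_split:
  assumes "n \<in> digit_sums g D (L + K)"
  obtains r q where "r \<in> digit_sums g D L" "q \<in> digit_sums g D K" "n = r + g ^ L * q"
  using assms
proof (induction K arbitrary: n thesis)
  case 0
  then show ?case by simp
next
  case (Suc K)
  then obtain n' x where n': "n' \<in> digit_sums g D (L + K)" and x: "x \<in> D"
    and n: "n = n' + x * g ^ (L + K)" by auto
  obtain r q where *: "r \<in> digit_sums g D L" "q \<in> digit_sums g D K" "n' = r + g ^ L * q"
    using Suc.IH n' by blast
  have "q + x * g ^ K \<in> digit_sums g D (Suc K)"
    using * x by force
  moreover have "n = r + g ^ L * (q + x * g ^ K)"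
    using n * by (simp add: algebra_simps power_add)
  ultimately show ?case using Suc.prems(1) *(1) by blast
qed

declare digit_sums.simps(2) [simp del]

section \<open>Reaching every residue class modulo \<open>a\<close>\<close>

text \<open>Modulo \<open>a\<close> a submonoid is a subgroup, since adding \<open>a - 1\<close>
  copies of an element subtracts it. Division with remainder then shows that the least positive
  element of \<open>X\<close> divides all of \<open>X\<close>, in particular \<open>a\<close> and
  \<open>S\<close>.\<close>

lemma additive_cong_closed_contains_1:
  fixes X :: "nat set" and a :: nat
  assumes "a \<ge> 1" and zero: "0 \<in> X"
    and add: "\<And>x y. x \<in> X \<Longrightarrow> y \<in> X \<Longrightarrow> x + y \<in> X"
    and cong: "\<And>x y. x \<in> X \<Longrightarrow> [x = y] (mod a) \<Longrightarrow> y \<in> X"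
    and "S \<subseteq> X" and "Gcd (insert a S) = 1"
  shows "1 \<in> X"
proof -
  have mult: "k * x \<in> X" if "x \<in> X" for k x
    by (induction k) (use that zero add in auto)
  have aX: "a \<in> X" using cong[OF zero, of a] by (simp add: cong_def)
  define p where "p = (LEAST p. p \<in> X \<and> p > 0)"
  have p: "p \<in> X" "p > 0"
    using LeastI[of "\<lambda>p. p \<in> X \<and> p > 0" a] aX assms(1) by (auto simp: p_def)
  have p_dvd: "p dvd x" if "x \<in> X" for x
  proof -
    \<comment> \<open>The \<open>(a - 1) * (x div p)\<close> copies of \<open>p\<close> stand for
      subtracting \<open>(x div p) * p\<close>.\<close>
    have "x + (a * (x div p) - (x div p)) * p \<in> X"
      using add mult that p(1) by blast
    moreover have "x + (a * (x div p) - (x div p)) * p = x mod p + a * ((x div p) * p)"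
    proof -
      have "x div p \<le> a * (x div p)" using assms(1) by simp
      then have "(a * (x div p) - (x div p)) * p + (x div p) * p = a * ((x div p) * p)"
        by (metis add_mult_distrib le_add_diff_inverse2 mult.assoc)
      then show ?thesis using div_mult_mod_eq[of x p] by linarith
    qed
    ultimately have "x mod p \<in> X"
      using cong[of "x mod p + a * ((x div p) * p)" "x mod p"] by (simp add: cong_def)
    moreover have "x mod p < p" using p(2) by simp
    ultimately have "x mod p = 0"
      using not_less_Least[of "x mod p" "\<lambda>p. p \<in> X \<and> p > 0"] unfolding p_def[symmetric] by auto
    then show ?thesis by auto
  qed
  have "p dvd Gcd (insert a S)"
    using p_dvd aX assms(5) by (intro Gcd_greatest) auto
  then have "p = 1" unfolding assms(6) by simp
  then show ?thesis using p(1) by simp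
qed

text \<open>Modulo \<open>a\<close>, digits at positions divisible by \<open>totient a\<close> have weight 1, so sums
  of such digits move through the submonoid generated by the digit differences.\<close>
lemma digit_sums_hit_all_residues:
  assumes "a \<ge> 1" "coprime g a" "d0 \<in> D"
    and min: "\<And>x. x \<in> D \<Longrightarrow> d0 \<le> x"
    and gcd: "Gcd (insert a ((\<lambda>x. x - d0) ` D)) = 1"
  obtains L where "[g ^ L = 1] (mod a)"
    "\<And>s. \<exists>r\<in>digit_sums g D L. [r = s] (mod a)"
proof -
  define p where "p = totient a"
  have "p > 0" using assms(1) by (simp add: p_def)
  then obtain p' where p': "p = Suc p'" using gr0_implies_Suc by blast
  have gp: "[g ^ p = 1] (mod a)" using euler_theorem[OF assms(2)] by (simp add: p_def)
  have gkp: "[g ^ (k * p) = 1] (mod a)" for k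
    using cong_pow[OF gp, of k] by (simp add: power_mult[symmetric] mult.commute)
  have "\<exists>q. q \<in> digit_sums g D L" for L
    using assms(3) by (induction L) (auto simp: digit_sums.simps(2))
  then obtain q where q: "q \<in> digit_sums g D p'" by blast
  \<comment> \<open>Value of a reference block of \<open>p\<close> digits: lowest digit
    \<open>d0\<close>, the others fixed to spell \<open>q\<close>. Replacing \<open>d0\<close> by
    \<open>x\<close> raises it by exactly \<open>x - d0\<close>.\<close>
  define base where "base = d0 + g * q"
  have one: "\<exists>r\<in>digit_sums g D p. r = (x - d0) + base" if "x \<in> D" for x
  proof
    show "x + g * q \<in> digit_sums g D p"
      using digit_sums_append[of x g D "Suc 0" q p'] that q p' by simp
    show "x + g * q = (x - d0) + base" using min[OF that] by (simp add: base_def)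
  qed
  \<comment> \<open>The increments over \<open>k\<close> reference blocks attainable by
    \<open>k\<close> blocks of \<open>p\<close> digits. Blocks have weight 1 modulo
    \<open>a\<close>, so increments add up when strings are concatenated.\<close>
  define X where
    "X k = {x. \<exists>r\<in>digit_sums g D (k * p). [r = x + k * base] (mod a)}" for k
  have X_add: "x + y \<in> X (k + l)" if xy: "x \<in> X k" "y \<in> X l" for x y k l
  proof -
    obtain r s where r: "r \<in> digit_sums g D (k * p)" "[r = x + k * base] (mod a)"
      and s: "s \<in> digit_sums g D (l * p)" "[s = y + l * base] (mod a)"
      using xy by (auto simp: X_def)
    have "r + g ^ (k * p) * s \<in> digit_sums g D ((k + l) * p)"
      using digit_sums_append[OF r(1) s(1)] by (simp add: algebra_simps)
    moreover have "[r + g ^ (k * p) * s = (x + k * base) + 1 * (y + l * base)] (mod a)"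
      by (intro cong_add cong_mult r s gkp)
    ultimately show ?thesis by (auto simp: X_def algebra_simps)
  qed
  have diff_X: "x - d0 \<in> X 1" if "x \<in> D" for x
    using one[OF that] by (auto simp: X_def intro: cong_refl)
  \<comment> \<open>A reference block adds increment 0, so strings can be padded and
    \<open>X\<close> grows with \<open>k\<close>.\<close>
  have zero1: "0 \<in> X 1" using diff_X[OF assms(3)] by simp
  have zero0: "0 \<in> X 0" by (simp add: X_def)
  have zero: "0 \<in> X k" for k
    by (induction k) (use zero0 X_add[OF _ zero1, of 0] in auto)
  have X_mono: "x \<in> X l" if "x \<in> X k" "k \<le> l" for x k l
    using X_add[OF that(1) zero[of "l - k"]] that(2) by simp
  have X_cong: "y \<in> X k" if "x \<in> X k" "[x = y] (mod a)" for x y k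
    using that unfolding X_def mem_Collect_eq
    by (meson cong_add_rcancel_nat cong_trans)
  have "1 \<in> (\<Union>k. X k)"
  proof (rule additive_cong_closed_contains_1[OF assms(1) _ _ _ _ gcd])
    show "0 \<in> (\<Union>k. X k)" using zero by blast
    show "(\<lambda>x. x - d0) ` D \<subseteq> (\<Union>k. X k)" using diff_X by blast
    show "x + y \<in> (\<Union>k. X k)" if "x \<in> (\<Union>k. X k)" "y \<in> (\<Union>k. X k)" for x y
      using that X_add by blast
    show "y \<in> (\<Union>k. X k)" if "x \<in> (\<Union>k. X k)" "[x = y] (mod a)" for x y
      using that X_cong by blast
  qed
  then obtain k where k: "1 \<in> X k" by blast
  have mult: "n \<in> X (n * k)" for n
  proof (induction n)
    case 0
    show ?case by (simp add: zero0)
  next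
    case (Suc n)
    show ?case using X_add[OF Suc k] by (simp add: add.commute)
  qed
  \<comment> \<open>The length \<open>a * k * p\<close> serves all residues at once: each
    \<open>y < a\<close> lies in \<open>X (y * k)\<close>, hence in
    \<open>X (a * k)\<close>.\<close>
  show thesis
  proof
    show "[g ^ (a * k * p) = 1] (mod a)" by (rule gkp)
    fix s
    \<comment> \<open>The \<open>a - 1\<close> further copies of the offset
      \<open>a * k * base\<close> represent its negative modulo \<open>a\<close>.\<close>
    define y where "y = (s + (a - 1) * (a * k * base)) mod a"
    have "y < a" using assms(1) by (simp add: y_def)
    then have "y \<in> X (a * k)" using X_mono[OF mult[of y]] by simp
    then obtain r where r: "r \<in> digit_sums g D (a * k * p)"
      and ry: "[r = y + a * k * base] (mod a)" by (auto simp: X_def)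
    have "[y + a * k * base = s + (a - 1) * (a * k * base) + a * k * base] (mod a)"
      by (intro cong_add) (auto simp: y_def cong_def)
    also have "s + (a - 1) * (a * k * base) + a * k * base = s + a * (a * k * base)"
      using assms(1) by (cases a) auto
    also have "[s + a * (a * k * base) = s] (mod a)" by (simp add: cong_def)
    finally have "[r = s] (mod a)" using ry cong_trans by blast
    with r show "\<exists>r\<in>digit_sums g D (a * k * p). [r = s] (mod a)" by blast
  qed
qed

lemma obtain_complete_residue_system:
  fixes a :: nat
  assumes "\<And>s. \<exists>r\<in>A. [r = s] (mod a)"
  obtains f where "\<And>s. f s \<in> A" "\<And>s. [f s = s] (mod a)" "inj_on f {..<a}"
proof -
  obtain f where f: "\<And>s. f s \<in> A" "\<And>s. [f s = s] (mod a)"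
    using assms by metis
  have "inj_on f {..<a}"
  proof (rule inj_onI)
    fix s s' assume "s \<in> {..<a}" "s' \<in> {..<a}" "f s = f s'"
    then show "s = s'"
      using f(2)[of s] f(2)[of s'] by (simp add: cong_def)
  qed
  with f show thesis using that by blast
qed

section \<open>Counting elements below a bound\<close>

locale missing_digits =
  fixes g :: nat and D :: "nat set"
  assumes g_ge_2: "g \<ge> 2" and D_subset: "D \<subseteq> {..<g}"
begin

abbreviation "W \<equiv> digit_sums g D"
abbreviation "C \<equiv> missing_digits_set g D"

lemma digit_sums_less: "r \<in> W L \<Longrightarrow> r < g ^ L"
proof (induction L arbitrary: r)
  case 0
  then show ?case by simp
next
  case (Suc L)
  then obtain s x where s: "s \<in> W L" and x: "x \<in> D" and r: "r = s + x * g ^ L"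
    by (auto simp: digit_sums.simps(2))
  have "r < (x + 1) * g ^ L" using Suc.IH[OF s] r by simp
  also have "\<dots> \<le> g * g ^ L" using x D_subset by (intro mult_right_mono) auto
  finally show ?case by simp
qed

lemma finite_digit_sums: "finite (W L)"
  using digit_sums_less by (intro finite_subset[of "W L" "{..<g ^ L}"]) auto

text \<open>The predicate is a parameter because the recursion replaces \<open>P\<close> by its
  shifts \<open>P (r + g ^ L * q)\<close>.\<close>

definition count :: "(nat \<Rightarrow> bool) \<Rightarrow> nat \<Rightarrow> nat" where
  "count P N = card {n \<in> C. P n \<and> n < N}"

lemma count_mono: "N \<le> N' \<Longrightarrow> count P N \<le> count P N'"
  unfolding count_def by (intro card_mono) auto

lemma append_in_C:
  assumes "r \<in> W L" "q \<in> C"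
  shows "r + g ^ L * q \<in> C"
proof -
  obtain m where "q \<in> W (Suc m)" using assms(2) by (auto simp: missing_digits_set_eq)
  from digit_sums_append[OF assms(1) this] have "r + g ^ L * q \<in> W (Suc (L + m))" by simp
  then show ?thesis unfolding missing_digits_set_eq by blast
qed

text \<open>Cutting off the lowest \<open>L\<close> digits is injective because
  \<open>r < g ^ L\<close>. The error has two sources of size at most \<open>g ^ L\<close> each:
  numbers with at most \<open>L\<close> digits, which leave no digit for \<open>q\<close>, and the
  incomplete top interval from \<open>g ^ L * (N div g ^ L)\<close> on.\<close>

lemma count_recursion:
  shows "(\<Sum>r\<in>W L. count (\<lambda>q. P (r + g ^ L * q)) (N div g ^ L)) \<le> count P N" (is "?S \<le> _")
    and "count P N \<le> (\<Sum>r\<in>W L. count (\<lambda>q. P (r + g ^ L * q)) (N div g ^ L)) + 2 * g ^ L"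
proof -
  define G where "G = g ^ L"
  have G: "G > 0" using g_ge_2 by (simp add: G_def)
  define M where "M = N div G"
  have MN: "G * M \<le> N" "N < G * M + G"
    using G dividend_less_times_div[of G N] by (auto simp: M_def)
  define Q where "Q = (\<lambda>r. {q \<in> C. P (r + G * q) \<and> q < M})"
  define B where "B = (\<lambda>(r, q). r + G * q) ` (SIGMA r:W L. Q r)"
  have inj: "inj_on (\<lambda>(r, q). r + G * q) (SIGMA r:W L. Q r)"
  proof (rule inj_onI, clarify)
    fix r q r' q' assume "r \<in> W L" "r' \<in> W L" and eq: "r + G * q = r' + G * q'"
    then have "r < G" "r' < G" using digit_sums_less by (auto simp: G_def)
    then have "r = (r + G * q) mod G" "r' = (r' + G * q') mod G" by simp_all
    then have "r = r'" using eq by simp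
    with eq G show "r = r' \<and> q = q'" by simp
  qed
  have finQ: "finite (Q r)" for r by (simp add: Q_def)
  have cardB: "card B = ?S"
    unfolding B_def card_image[OF inj]
    by (simp add: finite_digit_sums finQ) (simp add: Q_def count_def G_def M_def)
  have BN: "B \<subseteq> {n \<in> C. P n \<and> n < N}"
  proof
    fix n assume "n \<in> B"
    then obtain r q where r: "r \<in> W L" and q: "q \<in> C" "P (r + G * q)" "q < M"
      and n: "n = r + G * q" by (auto simp: B_def Q_def)
    have "r + G * q < G * Suc q" using digit_sums_less[OF r] by (simp add: G_def)
    also have "\<dots> \<le> G * M" using q by (intro mult_left_mono) auto
    finally show "n \<in> {n \<in> C. P n \<and> n < N}"
      using append_in_C[OF r q(1)] q MN n by (simp add: G_def)
  qed
  then show "?S \<le> count P N"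
    unfolding cardB[symmetric] unfolding count_def by (intro card_mono) auto
  \<comment> \<open>Numbers outside \<open>B\<close> either come from a string of length at most
    \<open>L\<close>, so are below \<open>G\<close>, or have quotient at least
    \<open>M\<close>.\<close>
  have "{n \<in> C. P n \<and> n < N} \<subseteq> B \<union> ({..<G} \<union> {G * M..<G * M + G})"
  proof
    fix n assume n: "n \<in> {n \<in> C. P n \<and> n < N}"
    then obtain m where m: "n \<in> W (Suc m)" by (auto simp: missing_digits_set_eq)
    show "n \<in> B \<union> ({..<G} \<union> {G * M..<G * M + G})"
    proof (cases "L \<le> m")
      case True
      then have "n \<in> W (L + Suc (m - L))" using m by simp
      then obtain r q where rq: "r \<in> W L" "q \<in> W (Suc (m - L))" "n = r + G * q"
        unfolding G_def by (rule digit_sums_split)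
      have qC: "q \<in> C" using rq(2) unfolding missing_digits_set_eq by blast
      show ?thesis
      proof (cases "q < M")
        case True
        then show ?thesis using rq qC n by (auto simp: B_def Q_def)
      next
        case False
        then have "G * M \<le> G * q" by simp
        then have "G * M \<le> n" unfolding rq(3) by (rule trans_le_add2)
        moreover have "n < G * M + G" using n MN by auto
        ultimately show ?thesis by simp
      qed
    next
      case False
      have "n < g ^ Suc m" using m by (rule digit_sums_less)
      also have "\<dots> \<le> G" unfolding G_def using False g_ge_2 by (intro power_increasing) auto
      finally show ?thesis by simp
    qed
  qed
  then have "count P N \<le> card (B \<union> ({..<G} \<union> {G * M..<G * M + G}))"
    unfolding count_def
    by (intro card_mono) (auto simp: B_def finite_digit_sums finQ)
  also have "\<dots> \<le> card B + (card {..<G} + card {G * M..<G * M + G})"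
    by (meson add_left_mono card_Un_le order_trans)
  also have "\<dots> = card B + 2 * G" by simp
  finally show "count P N \<le> ?S + 2 * g ^ L" unfolding cardB by (simp add: G_def)
qed

text \<open>Each element below \<open>g ^ m\<close> can be extended by any of at least two lowest
  digits.\<close>

lemma count_power_ge:
  assumes "card D \<ge> 2"
  shows "2 * count (\<lambda>_. True) (g ^ m) \<le> count (\<lambda>_. True) (g ^ Suc m)"
proof -
  have "2 * count (\<lambda>_. True) (g ^ m) \<le> card D * count (\<lambda>_. True) (g ^ m)"
    using assms by simp
  also have "\<dots> \<le> count (\<lambda>_. True) (g ^ Suc m)"
    using count_recursion(1)[where L = 1 and N = "g ^ Suc m" and P = "\<lambda>_. True"] g_ge_2 by simp
  finally show ?thesis .
qed

lemma count_power_ge_2_power: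
  assumes "card D \<ge> 2"
  shows "2 ^ m \<le> count (\<lambda>_. True) (g ^ Suc m)"
proof (induction m)
  case 0
  obtain x where "x \<in> D" using assms by fastforce
  then have "x \<in> {n \<in> C. True \<and> n < g ^ Suc 0}"
    using D_subset by (auto simp: missing_digits_set_eq intro!: exI[of _ 0])
  then have "count (\<lambda>_. True) (g ^ Suc 0) \<noteq> 0"
    unfolding count_def by (subst card_0_eq) auto
  then show ?case by simp
next
  case (Suc m)
  then show ?case using count_power_ge[OF assms, of "Suc m"] by simp
qed

text \<open>This makes the bounded additive errors of the recursion negligible relative to the total
  count.\<close>

lemma filterlim_count:
  assumes "card D \<ge> 2"
  shows "filterlim (\<lambda>N. real (count (\<lambda>_. True) N)) at_top sequentially"
proof -
  have "filterlim (count (\<lambda>_. True)) at_top sequentially"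
    unfolding filterlim_at_top eventually_sequentially
  proof (intro allI exI impI)
    fix Z N :: nat assume "g ^ Suc Z \<le> N"
    have "Z \<le> 2 ^ Z" using less_exp[of Z] by simp
    also have "\<dots> \<le> count (\<lambda>_. True) (g ^ Suc Z)" using count_power_ge_2_power[OF assms] .
    also have "\<dots> \<le> count (\<lambda>_. True) N" using count_mono[OF \<open>g ^ Suc Z \<le> N\<close>] .
    finally show "Z \<le> count (\<lambda>_. True) N" .
  qed
  then show ?thesis using filterlim_compose[OF filterlim_real_sequentially] by blast
qed

lemma uniformly_distributed_mod_iff:
  "uniformly_distributed_mod C a \<longleftrightarrow>
     (\<forall>b<a. (\<lambda>N. real (count (\<lambda>n. [n = b] (mod a)) N) / real (count (\<lambda>_. True) N))
        \<longlonglongrightarrow> 1 / real a)"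
proof -
  have "{n \<in> C. P n} \<inter> {0..<N} = {n \<in> C. P n \<and> n < N}" for P N by auto
  moreover have "C \<inter> {0..<N} = {n \<in> C. True \<and> n < N}" for N by auto
  ultimately show ?thesis unfolding uniformly_distributed_mod_def count_def by simp
qed

section \<open>Contraction of the deviation from equidistribution\<close>

text \<open>Left unnormalised, so that it is linear in the counts and can be summed over the
  remainders \<open>r\<close>.\<close>

definition deviation :: "nat \<Rightarrow> nat \<Rightarrow> nat \<Rightarrow> real" where
  "deviation a b N =
     real (count (\<lambda>n. [n = b] (mod a)) N) - real (count (\<lambda>_. True) N) / real a"

text \<open>The summands of a complete residue system \<open>R\<close> contribute no deviation.\<close>
lemma deviation_recursion:
  fixes v :: real
  assumes a: "a \<ge> 1" and gL: "[g ^ L = 1] (mod a)"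
    and hit: "\<And>s. \<exists>r\<in>W L. [r = s] (mod a)"
    and bound: "\<And>b. \<bar>deviation a b (N div g ^ L)\<bar> \<le> v * count (\<lambda>_. True) (N div g ^ L)"
  shows "\<bar>deviation a b N\<bar> \<le>
    (real (card (W L)) - a) * (v * count (\<lambda>_. True) (N div g ^ L)) + 4 * g ^ L"
proof -
  define M where "M = N div g ^ L"
  define T where "T = (\<lambda>N. real (count (\<lambda>_. True) N))"
  define Tb where "Tb = (\<lambda>b N. real (count (\<lambda>n. [n = b] (mod a)) N))"
  \<comment> \<open>Represents \<open>b - r\<close> modulo \<open>a\<close> without subtraction: the
    class that \<open>q\<close> must lie in.\<close>
  define sh where "sh = (\<lambda>r. b + (a - 1) * r)"
  have sh: "[r + g ^ L * q = b] (mod a) \<longleftrightarrow> [q = sh r] (mod a)" for r q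
  proof -
    have "[r + g ^ L * q = r + 1 * q] (mod a)" by (intro cong_add cong_mult gL cong_refl)
    then have "[r + g ^ L * q = b] (mod a) \<longleftrightarrow> [r + q = b] (mod a)"
      by (metis cong_sym cong_trans mult_1)
    also have "[b = r + sh r] (mod a)"
    proof -
      have "r + sh r = b + a * r" using a by (cases a) (auto simp: sh_def)
      then show ?thesis by (simp add: cong_def)
    qed
    then have "[r + q = b] (mod a) \<longleftrightarrow> [r + q = r + sh r] (mod a)"
      by (meson cong_sym cong_trans)
    finally show ?thesis by (simp add: cong_add_lcancel_nat)
  qed
  have recb: "\<bar>Tb b N - (\<Sum>r\<in>W L. Tb (sh r) M)\<bar> \<le> 2 * g ^ L"
  proof -
    let ?s = "\<Sum>r\<in>W L. count (\<lambda>q. [q = sh r] (mod a)) M"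
    have "?s \<le> count (\<lambda>n. [n = b] (mod a)) N"
      "count (\<lambda>n. [n = b] (mod a)) N \<le> ?s + 2 * g ^ L"
      using count_recursion[where P = "\<lambda>n. [n = b] (mod a)" and L = L and N = N]
      by (simp_all add: sh M_def)
    then have "real ?s \<le> Tb b N" "Tb b N \<le> real (?s + 2 * g ^ L)"
      unfolding Tb_def of_nat_le_iff by auto
    then show ?thesis unfolding Tb_def by (simp add: abs_le_iff)
  qed
  have rec: "\<bar>T N - card (W L) * T M\<bar> \<le> 2 * g ^ L"
  proof -
    have "card (W L) * count (\<lambda>_. True) M \<le> count (\<lambda>_. True) N"
      "count (\<lambda>_. True) N \<le> card (W L) * count (\<lambda>_. True) M + 2 * g ^ L"
      using count_recursion[where P = "\<lambda>_. True" and L = L and N = N] by (simp_all add: M_def)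
    then have "real (card (W L) * count (\<lambda>_. True) M) \<le> T N"
      "T N \<le> real (card (W L) * count (\<lambda>_. True) M + 2 * g ^ L)"
      unfolding T_def of_nat_le_iff by auto
    then show ?thesis unfolding T_def by (simp add: abs_le_iff)
  qed
  obtain f where f: "\<And>s. f s \<in> W L" "\<And>s. [f s = s] (mod a)" and injf: "inj_on f {..<a}"
    using obtain_complete_residue_system[OF hit] by blast
  define R where "R = f ` {..<a}"
  have RW: "R \<subseteq> W L" using f by (auto simp: R_def)
  have cardR: "card R = a" using injf by (simp add: R_def card_image)
  have finR: "finite R" by (simp add: R_def)
  \<comment> \<open>For each \<open>q\<close> exactly one \<open>r\<close> in \<open>R\<close> puts
    \<open>r + g ^ L * q\<close> into the class of \<open>b\<close>, so the sets counted here
    partition the elements below \<open>M\<close>.\<close>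
  have R_sum: "(\<Sum>r\<in>R. Tb (sh r) M) = T M"
  proof -
    have one: "\<exists>!s. s < a \<and> [f s + g ^ L * q = b] (mod a)" for q
    proof -
      define s where "s = (b + (a - 1) * (g ^ L * q)) mod a"
      have iff: "[f s' + g ^ L * q = b] (mod a) \<longleftrightarrow> [s' = s] (mod a)" for s'
      proof -
        have "[f s' + g ^ L * q = b] (mod a) \<longleftrightarrow> [s' + g ^ L * q = b] (mod a)"
          by (meson f(2) cong_add_rcancel_nat cong_sym cong_trans)
        moreover have "[b = s + g ^ L * q] (mod a)"
        proof -
          have "[s + g ^ L * q = b + (a - 1) * (g ^ L * q) + g ^ L * q] (mod a)"
            unfolding s_def by (intro cong_add) (auto simp: cong_def)
          also have "b + (a - 1) * (g ^ L * q) + g ^ L * q = b + a * (g ^ L * q)"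
            using a by (cases a) auto
          also have "[\<dots> = b] (mod a)" by (simp add: cong_def)
          finally show ?thesis by (rule cong_sym)
        qed
        ultimately show ?thesis by (meson cong_add_rcancel_nat cong_sym cong_trans)
      qed
      have "s < a" using a by (simp add: s_def)
      then show ?thesis unfolding iff by (metis cong_less_modulus_unique_nat cong_refl)
    qed
    let ?A = "\<lambda>s. {q \<in> C. [f s + g ^ L * q = b] (mod a) \<and> q < M}"
    have "(\<Sum>s<a. card (?A s)) = card (\<Union>s<a. ?A s)"
      using one by (intro card_UN_disjoint[symmetric]) auto
    also have "(\<Union>s<a. ?A s) = {q \<in> C. True \<and> q < M}" using one by blast
    finally have "(\<Sum>s<a. count (\<lambda>q. [q = sh (f s)] (mod a)) M) = count (\<lambda>_. True) M"
      by (simp add: count_def sh)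
    then have "(\<Sum>s<a. Tb (sh (f s)) M) = T M"
      unfolding Tb_def T_def by (metis of_nat_sum)
    then show ?thesis unfolding R_def sum.reindex[OF injf] by simp
  qed
  define E where "E = (\<Sum>r\<in>W L - R. deviation a (sh r) M)"
  \<comment> \<open>The \<open>a\<close> terms from \<open>R\<close> sum to \<open>T M\<close>,
    which is \<open>a\<close> times the expected \<open>T M / a\<close>; only the other
    \<open>card (W L) - a\<close> deviations survive.\<close>
  have split: "(\<Sum>r\<in>W L. Tb (sh r) M) - card (W L) * T M / a = E"
  proof -
    have "(\<Sum>r\<in>W L. Tb (sh r) M) = (\<Sum>r\<in>W L - R. Tb (sh r) M) + T M"
      unfolding R_sum[symmetric] using sum.subset_diff[OF RW finite_digit_sums] .
    moreover have "E = (\<Sum>r\<in>W L - R. Tb (sh r) M) - card (W L - R) * (T M / a)"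
      by (simp add: E_def deviation_def Tb_def T_def sum_subtractf)
    moreover have "real (card (W L - R)) = real (card (W L)) - a"
      using card_Diff_subset[OF finR RW] card_mono[OF finite_digit_sums RW] cardR by simp
    ultimately show ?thesis using a by (simp add: field_simps)
  qed
  have "\<bar>E\<bar> \<le> (\<Sum>r\<in>W L - R. v * T M)"
    unfolding E_def using bound
    by (intro order_trans[OF sum_abs] sum_mono) (simp add: M_def T_def)
  also have "\<dots> = (real (card (W L)) - a) * (v * T M)"
    using card_Diff_subset[OF finR RW] card_mono[OF finite_digit_sums RW] cardR by simp
  finally have E: "\<bar>E\<bar> \<le> (real (card (W L)) - a) * (v * T M)" .
  \<comment> \<open>The error \<open>4 * g ^ L\<close> is \<open>2 * g ^ L\<close> from the class
    count plus at most as much from the total, whose error is divided by \<open>a\<close>.\<close>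
  have "\<bar>T N / a - card (W L) * T M / a\<bar> = \<bar>T N - card (W L) * T M\<bar> / a"
    by (simp add: diff_divide_distrib[symmetric])
  also have "\<dots> \<le> \<bar>T N - card (W L) * T M\<bar> / 1"
    using a by (intro divide_left_mono) auto
  also have "\<dots> \<le> 2 * g ^ L" using rec by simp
  finally have "\<bar>T N / a - card (W L) * T M / a\<bar> \<le> 2 * g ^ L" .
  moreover have "deviation a b N = Tb b N - T N / a" by (simp add: deviation_def Tb_def T_def)
  ultimately have "\<bar>deviation a b N\<bar> \<le> \<bar>E\<bar> + 4 * g ^ L"
    using recb split by linarith
  then show ?thesis using E by (simp add: M_def T_def)
qed

text \<open>With \<open>w = card (W L)\<close>, the recursion contracts by \<open>1 - a / w\<close>,
  since the total at \<open>N div g ^ L\<close> is at most \<open>1 / w\<close> of that at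
  \<open>N\<close>. The weaker factor \<open>c\<close> leaves a share \<open>a / (2 * w)\<close> to
  absorb the additive error for large \<open>N\<close>. The bound is uniform in \<open>b\<close>
  because the recursion mixes classes.\<close>

lemma eventually_deviation_le:
  assumes D: "card D \<ge> 2" and a: "a \<ge> 1" and gL: "[g ^ L = 1] (mod a)"
    and hit: "\<And>s. \<exists>r\<in>W L. [r = s] (mod a)"
  defines "c \<equiv> 1 - real a / (2 * real (card (W L)))"
  shows "\<forall>\<^sub>F N in sequentially. \<forall>b. \<bar>deviation a b N\<bar> \<le> c ^ k * count (\<lambda>_. True) N"
proof (induction k)
  case 0
  have "\<bar>deviation a b N\<bar> \<le> count (\<lambda>_. True) N" for b N
  proof -
    have "count (\<lambda>n. [n = b] (mod a)) N \<le> count (\<lambda>_. True) N"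
      unfolding count_def by (intro card_mono) auto
    moreover have "real (count (\<lambda>_. True) N) / real a \<le> count (\<lambda>_. True) N / 1"
      using a by (intro divide_left_mono) auto
    moreover have "real (count (\<lambda>_. True) N) / real a \<ge> 0" by simp
    ultimately show ?thesis unfolding deviation_def abs_le_iff by linarith
  qed
  then show ?case by simp
next
  case (Suc k)
  define w where "w = real (card (W L))"
  \<comment> \<open>All \<open>a\<close> classes are hit, so \<open>w - a\<close> is nonnegative and
    \<open>c\<close> is at least one half.\<close>
  have aw: "real a \<le> w"
  proof -
    obtain f where f: "\<And>s. f s \<in> W L" "\<And>s. [f s = s] (mod a)" and injf: "inj_on f {..<a}"
      using obtain_complete_residue_system[OF hit] by blast
    have "card {..<a} \<le> card (W L)"
      using f(1) injf finite_digit_sums by (intro card_inj_on_le) auto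
    then show ?thesis by (simp add: w_def)
  qed
  have w: "w > 0" using aw a by simp
  have c: "c > 0" unfolding c_def w_def[symmetric] using aw w by (simp add: field_simps)
  have G: "g ^ L > 0" using g_ge_2 by simp
  have "filterlim (\<lambda>N. N div g ^ L) at_top sequentially"
    unfolding filterlim_at_top eventually_sequentially
  proof (intro allI exI impI)
    fix Z N assume "Z * g ^ L \<le> N"
    then show "Z \<le> N div g ^ L" using G by (simp add: less_eq_div_iff_mult_less_eq)
  qed
  from eventually_compose_filterlim[OF Suc.IH this]
  have ev1: "\<forall>\<^sub>F N in sequentially.
    \<forall>b. \<bar>deviation a b (N div g ^ L)\<bar> \<le> c ^ k * count (\<lambda>_. True) (N div g ^ L)" .
  \<comment> \<open>The threshold from which \<open>4 * g ^ L\<close> fits into the share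
    \<open>a / (2 * w)\<close> of \<open>c ^ k\<close> times the total.\<close>
  have ev2: "\<forall>\<^sub>F N in sequentially. 4 * real (g ^ L) / (c ^ k * (a / (2 * w)))
      \<le> real (count (\<lambda>_. True) N)"
    using filterlim_count[OF D] unfolding filterlim_at_top by blast
  from ev1 ev2 show ?case
  proof eventually_elim
    case (elim N)
    define T where "T = real (count (\<lambda>_. True) N)"
    define TM where "TM = real (count (\<lambda>_. True) (N div g ^ L))"
    have "card (W L) * count (\<lambda>_. True) (N div g ^ L) \<le> count (\<lambda>_. True) N"
      using count_recursion(1)[where P = "\<lambda>_. True" and L = L and N = N] by simp
    then have "real (card (W L) * count (\<lambda>_. True) (N div g ^ L)) \<le> T"
      unfolding T_def of_nat_le_iff .
    then have "TM \<le> T / w" using w by (simp add: w_def TM_def field_simps)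
    then have 1: "(w - a) * (c ^ k * TM) \<le> (w - a) * (c ^ k * (T / w))"
      using aw c by (intro mult_left_mono) auto
    have 2: "4 * real (g ^ L) \<le> c ^ k * (a / (2 * w)) * T"
      using elim(2) c w a by (simp add: T_def field_simps)
    show ?case
    proof
      fix b
      have "\<bar>deviation a b N\<bar> \<le> (w - a) * (c ^ k * TM) + 4 * g ^ L"
        unfolding w_def TM_def using deviation_recursion[OF a gL hit] elim(1) by blast
      also have "\<dots> \<le> (w - a) * (c ^ k * (T / w)) + c ^ k * (a / (2 * w)) * T"
        using 1 2 by simp
      also have "\<dots> = c ^ Suc k * T"
        using w unfolding c_def w_def[symmetric] by (simp add: field_simps)
      finally show "\<bar>deviation a b N\<bar> \<le> c ^ Suc k * count (\<lambda>_. True) N" by (simp add: T_def)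
    qed
  qed
qed

lemma uniformly_distributed_if_all_residues_hit:
  assumes D: "card D \<ge> 2" and a: "a \<ge> 1" and gL: "[g ^ L = 1] (mod a)"
    and hit: "\<And>s. \<exists>r\<in>W L. [r = s] (mod a)"
  shows "uniformly_distributed_mod C a"
  unfolding uniformly_distributed_mod_iff
proof (intro allI impI LIMSEQ_I)
  fix b and \<epsilon> :: real assume "\<epsilon> > 0"
  define c where "c = 1 - real a / (2 * real (card (W L)))"
  have "card (W L) > 0"
    using hit[of 0] finite_digit_sums by (auto simp: card_gt_0_iff)
  then have "c < 1" using a by (simp add: c_def)
  then obtain k where k: "c ^ k < \<epsilon>"
    using real_arch_pow_inv[OF \<open>\<epsilon> > 0\<close>] by blast
  have ev: "\<forall>\<^sub>F N in sequentially. real (count (\<lambda>_. True) N) \<ge> 1"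
    using filterlim_count[OF D] unfolding filterlim_at_top by blast
  from eventually_deviation_le[OF D a gL hit, of k] ev
  have "\<forall>\<^sub>F N in sequentially. norm (real (count (\<lambda>n. [n = b] (mod a)) N) /
      real (count (\<lambda>_. True) N) - 1 / real a) < \<epsilon>"
  proof eventually_elim
    case (elim N)
    define T where "T = real (count (\<lambda>_. True) N)"
    have T: "T > 0" using elim by (simp add: T_def)
    have "real (count (\<lambda>n. [n = b] (mod a)) N) / T - 1 / real a = deviation a b N / T"
      using T a by (simp add: deviation_def T_def field_simps)
    moreover have "\<bar>deviation a b N\<bar> < \<epsilon> * T"
      using elim(1) k T unfolding c_def[symmetric] T_def[symmetric]
      by (meson mult_strict_right_mono order_le_less_trans)
    ultimately show ?case using T unfolding T_def[symmetric] by (simp add: field_simps)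
  qed
  then show "\<exists>no. \<forall>N\<ge>no. norm (real (count (\<lambda>n. [n = b] (mod a)) N) /
      real (count (\<lambda>_. True) N) - 1 / real a) < \<epsilon>"
    by (simp add: eventually_sequentially)
qed

section \<open>Failure of equidistribution when all digits agree modulo \<open>h\<close>\<close>

text \<open>All digits are \<open>d0\<close> modulo \<open>h\<close>, so only the length of the
  string matters. If \<open>d0 > 0\<close>, the leading digit is nonzero and the block determines
  the length; if \<open>d0 = 0\<close>, leading zeros may blur the length, but every sum is 0 modulo
  \<open>h\<close>.\<close>

lemma C_cong_on_block:
  assumes cong: "\<And>x. x \<in> D \<Longrightarrow> [x = d0] (mod h)"
    and min: "\<And>x. x \<in> D \<Longrightarrow> d0 \<le> x"
    and n: "n \<in> C" "g ^ m \<le> n" "n < g ^ Suc m"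
  shows "[n = d0 * (\<Sum>i\<le>m. g ^ i)] (mod h)"
proof -
  obtain k w where w: "\<forall>i\<le>k. w i \<in> D" and nw: "n = (\<Sum>i\<le>k. w i * g ^ i)"
    using n(1) by (auto simp: missing_digits_set_def)
  have nk: "[n = (\<Sum>i\<le>k. d0 * g ^ i)] (mod h)"
    unfolding nw using w cong by (intro cong_sum cong_mult cong_refl) auto
  show ?thesis
  proof (cases "d0 = 0")
    case True
    then show ?thesis using nk by simp
  next
    case False
    have "n \<in> W (Suc k)"
      unfolding digit_sums_eq lessThan_Suc_atMost less_Suc_eq_le using w nw by blast
    then have "n < g ^ Suc k" by (rule digit_sums_less)
    then have "g ^ m < g ^ Suc k" using n(2) by linarith
    then have "m < Suc k" using g_ge_2 by (simp add: power_strict_increasing_iff del: power_Suc)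
    moreover have "g ^ k \<le> n"
    proof -
      have "d0 \<le> w k" using min w by simp
      then have "g ^ k \<le> w k * g ^ k" using False by simp
      also have "\<dots> \<le> n" unfolding nw
        by (rule member_le_sum[where f = "\<lambda>i. w i * g ^ i" and i = k]) auto
      finally show ?thesis .
    qed
    then have "g ^ k < g ^ Suc m" using n(3) by linarith
    then have "k < Suc m" using g_ge_2 by (simp add: power_strict_increasing_iff del: power_Suc)
    ultimately have "k = m" by simp
    then show ?thesis using nk by (simp add: sum_distrib_left)
  qed
qed

text \<open>As \<open>0\<close> and \<open>1\<close> are distinct modulo \<open>h\<close>, each block \<open>[g^m, g^(m+1))\<close> misses one of these
  two classes modulo \<open>a\<close>, whose proportion is therefore at least halved by the block.\<close>
lemma not_uniformly_distributed_if_digits_cong: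
  assumes D: "card D \<ge> 2" and a: "a \<ge> 1" and h: "h dvd a" "h \<noteq> 1"
    and cong: "\<And>x. x \<in> D \<Longrightarrow> [x = d0] (mod h)"
    and min: "\<And>x. x \<in> D \<Longrightarrow> d0 \<le> x"
  shows "\<not> uniformly_distributed_mod C a"
proof
  assume ud: "uniformly_distributed_mod C a"
  define T where "T = (\<lambda>m. real (count (\<lambda>_. True) (g ^ m)))"
  define Tb where "Tb = (\<lambda>b m. real (count (\<lambda>n. [n = b] (mod a)) (g ^ m)))"
  have "a > 1" using a h by (cases "a = 1") auto
  have lim: "(\<lambda>m. Tb b m / T m) \<longlonglongrightarrow> 1 / a" if "b < a" for b
  proof -
    have "filterlim (\<lambda>m. g ^ m) at_top sequentially"
      unfolding filterlim_at_top eventually_sequentially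
    proof (intro allI exI impI)
      fix Z m :: nat assume "Z \<le> m"
      also have "m \<le> g ^ m" using g_ge_2 power_gt_expt[of g m] by simp
      finally show "Z \<le> g ^ m" .
    qed
    moreover have "(\<lambda>N. real (count (\<lambda>n. [n = b] (mod a)) N) / real (count (\<lambda>_. True) N))
        \<longlonglongrightarrow> 1 / real a"
      using ud that unfolding uniformly_distributed_mod_iff by simp
    ultimately show ?thesis
      unfolding T_def Tb_def by (rule filterlim_compose[rotated])
  qed
  \<comment> \<open>The limit \<open>1 / a\<close> lies strictly between the two bounds, and the
    lower one is half the upper, so halving the proportion is contradictory.\<close>
  have ev: "\<forall>\<^sub>F m in sequentially. Tb b m / T m < 6 / (5 * a) \<and> Tb b (Suc m) / T (Suc m) > 3 / (5 * a)"
    if "b < a" for b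
  proof (rule eventually_conj)
    show "\<forall>\<^sub>F m in sequentially. Tb b m / T m < 6 / (5 * a)"
      using order_tendstoD(2)[OF lim[OF that], of "6 / (5 * a)"] a by (simp add: field_simps)
    show "\<forall>\<^sub>F m in sequentially. Tb b (Suc m) / T (Suc m) > 3 / (5 * a)"
      using order_tendstoD(1)[OF LIMSEQ_Suc[OF lim[OF that]], of "3 / (5 * a)"] a
      by (simp add: field_simps)
  qed
  have "\<forall>\<^sub>F m in sequentially. False"
    using ev[OF order_less_trans[OF zero_less_one \<open>a > 1\<close>]] ev[OF \<open>a > 1\<close>]
      eventually_ge_at_top[of 1]
  proof eventually_elim
    case m: (elim m)
    define s where "s = d0 * (\<Sum>i\<le>m. g ^ i)"
    have "\<not> ([0 = s] (mod h) \<and> [1 = s] (mod h))"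
      using h(2) by (metis cong_sym cong_trans cong_0_1_nat)
    then obtain b where b: "b = 0 \<or> b = 1" "\<not> [b = s] (mod h)" by blast
    \<comment> \<open>The class of \<open>b\<close> gains no element in the block from
      \<open>g ^ m\<close> to \<open>g ^ Suc m\<close>, while the total at least doubles.\<close>
    have "n < g ^ m" if n: "n \<in> C" "[n = b] (mod a)" "n < g ^ Suc m" for n
    proof (rule ccontr)
      assume "\<not> n < g ^ m"
      then have "[n = s] (mod h)"
        unfolding s_def using C_cong_on_block[OF cong min n(1)] n(3) by simp
      moreover have "[n = b] (mod h)" using n(2) h(1) by (rule cong_dvd_modulus_nat)
      ultimately show False using b(2) by (meson cong_sym cong_trans)
    qed
    moreover have "n < g ^ Suc m" if "n < g ^ m" for n
    proof -
      have "g ^ m \<le> g ^ Suc m" using g_ge_2 by simp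
      with that show ?thesis by (rule order_less_le_trans)
    qed
    ultimately have "{n \<in> C. [n = b] (mod a) \<and> n < g ^ Suc m} =
        {n \<in> C. [n = b] (mod a) \<and> n < g ^ m}"
      by blast
    then have eq: "Tb b (Suc m) = Tb b m" by (simp add: Tb_def count_def)
    \<comment> \<open>From \<open>m = 1\<close> on there is an element below \<open>g ^ m\<close>,
      so the denominator is positive.\<close>
    obtain m' where "m = Suc m'" using m(3) by (cases m) auto
    then have "2 ^ m' \<le> count (\<lambda>_. True) (g ^ m)"
      using count_power_ge_2_power[OF D, of m'] by simp
    then have "count (\<lambda>_. True) (g ^ m) > 0"
      by (rule order_less_le_trans[rotated]) simp
    then have T: "T m > 0" by (simp add: T_def)
    have "real (2 * count (\<lambda>_. True) (g ^ m)) \<le> T (Suc m)"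
      unfolding T_def of_nat_le_iff by (rule count_power_ge[OF D])
    then have "2 * T m \<le> T (Suc m)" by (simp add: T_def)
    then have "Tb b m / T (Suc m) \<le> Tb b m / (2 * T m)"
      using T by (intro divide_left_mono) (auto simp: Tb_def)
    also have "\<dots> = (Tb b m / T m) / 2" by simp
    also have "\<dots> < 6 / (5 * a) / 2" using m b(1) by (intro divide_strict_right_mono) auto
    also have "\<dots> = 3 / (5 * a)" by simp
    also have "\<dots> < Tb b (Suc m) / T (Suc m)" using m b(1) by auto
    finally show False using eq by simp
  qed
  then show False by simp
qed

end

section \<open>The equivalence for digits listed in increasing order\<close>

theorem corollary1:
  fixes g a t :: nat and d :: "nat \<Rightarrow> nat" and D :: "nat set"
  assumes "g \<ge> 2"
    and "a \<ge> 1"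
    and "gcd g a = 1"
    and "t \<ge> 2"
    and "strict_mono_on {1..t} d"
    and "D = d ` {1..t}"
    and "D \<subseteq> {0..g - 1}"
  shows "uniformly_distributed_mod (missing_digits_set g D) a \<longleftrightarrow>
           Gcd (insert a ((\<lambda>i. d i - d 1) ` {2..t})) = 1"
proof -
  have "D \<subseteq> {..<g}" using assms(1,7) by fastforce
  with assms(1) interpret missing_digits g D by unfold_locales
  have D: "card D \<ge> 2"
    using assms(4,6) card_image[OF strict_mono_on_imp_inj_on[OF assms(5)]] by simp
  have d1: "d 1 \<in> D" using assms(4,6) by auto
  have min: "d 1 \<le> x" if "x \<in> D" for x
    using that assms(4,6) strict_mono_on_leD[OF assms(5)] by auto
  \<comment> \<open>The index 1 only adds the difference 0, which does not change the gcd.\<close>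
  have "{1..t} = insert 1 {2..t}" using assms(4) by auto
  then have "(\<lambda>x. x - d 1) ` D = insert 0 ((\<lambda>i. d i - d 1) ` {2..t})"
    by (simp add: assms(6) image_image)
  then have "Gcd (insert a ((\<lambda>i. d i - d 1) ` {2..t})) = Gcd (insert a ((\<lambda>x. x - d 1) ` D))"
    by simp
  moreover have "uniformly_distributed_mod C a"
    if "Gcd (insert a ((\<lambda>x. x - d 1) ` D)) = 1"
  proof -
    have "coprime g a" using assms(3) by (simp add: coprime_iff_gcd_eq_1)
    from digit_sums_hit_all_residues[OF assms(2) this d1 min that]
    show ?thesis using uniformly_distributed_if_all_residues_hit[OF D assms(2)] by blast
  qed
  \<comment> \<open>The gcd itself serves as \<open>h\<close>: it divides \<open>a\<close> and every
    difference to the least digit.\<close>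
  moreover have "\<not> uniformly_distributed_mod C a"
    if ne: "Gcd (insert a ((\<lambda>x. x - d 1) ` D)) \<noteq> 1" (is "?h \<noteq> 1")
  proof (rule not_uniformly_distributed_if_digits_cong[OF D assms(2) _ ne _ min])
    show "?h dvd a" by (rule Gcd_dvd) simp
    fix x assume x: "x \<in> D"
    then have "?h dvd x - d 1" by (intro Gcd_dvd) simp
    then show "[x = d 1] (mod ?h)"
      using min[OF x] by (simp add: cong_altdef_nat)
  qed
  ultimately show ?thesis by metis
qed

end
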